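(* Let $V$ be a right quaternionic Hilbert space and let $A\in\mathcal B(V)$ be semi-regular. Then $R_{\mathfrak q}(A)$ is semi-regular for all $\mathfrak q\in\mathbb H$ with $\gamma(A)>\beta(\mathfrak q)$, where $\beta(\mathfrak q)=|\mathrm{Re}(\mathfrak q)|+\sqrt{|\mathrm{Re}(\mathfrak q)|^2+|\mathfrak q|^2}$. Moreover, the Kato S-resolvent set $\rho_{ka}^S(A)$ is open in $\mathbb H$ and the Kato S-spectrum $\sigma_{ka}^S(A)$ is compact.
   Context: $\mathbb H$ denotes the quaternions. A right quaternionic Hilbert space $V$ is a right $\mathbb H$-vector space with an $\mathbb H$-valued inner product satisfying $\overline{\langle\phi|\psi\rangle}=\langle\psi|\phi\rangle$, additivity, $\langle\phi|\psi\mathfrak q\rangle=\langle\phi|\psi\rangle\mathfrak q$, $\langle\phi\mathfrak q|\psi\rangle=\overline{\mathfrak q}\langle\phi|\psi\rangle$ and $\|\phi\|^2=\langle\phi|\phi\rangle>0$ for $\phi\ne0$, complete in this norm and separable. $\mathcal B(V)$ is the set of bounded right $\mathbb H$-linear operators $V\to V$. For $\mathfrak q\in\mathbb H$, $R_{\mathfrak q}(A)=A^2-2\,\mathrm{Re}(\mathfrak q)A+|\mathfrak q|^2 I$. An operator $B\in\mathcal B(V)$ is semi-regular if $\mathrm{ran}(B)$ is closed and $\ker(B)\subseteq B^\infty(V):=\bigcap_{n\in\mathbb N}\mathrm{ran}(B^n)$. The Kato S-resolvent set is $\rho_{ka}^S(A)=\{\mathfrak q\in\mathbb H: R_{\mathfrak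 q}(A)\text{ is semi-regular}\}$, and $\sigma_{ka}^S(A)=\mathbb H\setminus\rho_{ka}^S(A)$. The reduced minimum modulus of $A\neq0$ is $\gamma(A)=\inf_{\phi\notin\ker(A)}\frac{\|A\phi\|}{\mathrm{dist}(\phi,\ker(A))}$, and $\gamma(0)=\infty$. *)

theory Defs
  imports "HOL-Analysis.Analysis"
begin

section \<open>Quaternions\<close>

codatatype quat = Quat (qRe: real) (qIm1: real) (qIm2: real) (qIm3: real)

lemma quat_eqI [intro?]:
  "\<lbrakk>qRe x = qRe y; qIm1 x = qIm1 y; qIm2 x = qIm2 y; qIm3 x = qIm3 y\<rbrakk> \<Longrightarrow> x = y"
  by (rule quat.expand) simp

lemma quat_eq_iff:
  "x = y \<longleftrightarrow> qRe x = qRe y \<and> qIm1 x = qIm1 y \<and> qIm2 x = qIm2 y \<and> qIm3 x = qIm3 y"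
  by (auto intro: quat.expand)

instantiation quat :: ring_1
begin

primcorec zero_quat where
  "qRe 0 = 0" | "qIm1 0 = 0" | "qIm2 0 = 0" | "qIm3 0 = 0"

primcorec one_quat where
  "qRe 1 = 1" | "qIm1 1 = 0" | "qIm2 1 = 0" | "qIm3 1 = 0"

primcorec plus_quat where
  "qRe (x + y) = qRe x + qRe y"
| "qIm1 (x + y) = qIm1 x + qIm1 y"
| "qIm2 (x + y) = qIm2 x + qIm2 y"
| "qIm3 (x + y) = qIm3 x + qIm3 y"

primcorec uminus_quat where
  "qRe (- x) = - qRe x"
| "qIm1 (- x) = - qIm1 x"
| "qIm2 (- x) = - qIm2 x"
| "qIm3 (- x) = - qIm3 x"

primcorec minus_quat where
  "qRe (x - y) = qRe x - qRe y"
| "qIm1 (x - y) = qIm1 x - qIm1 y"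
| "qIm2 (x - y) = qIm2 x - qIm2 y"
| "qIm3 (x - y) = qIm3 x - qIm3 y"

primcorec times_quat where
  "qRe (x * y) = qRe x * qRe y - qIm1 x * qIm1 y - qIm2 x * qIm2 y - qIm3 x * qIm3 y"
| "qIm1 (x * y) = qRe x * qIm1 y + qIm1 x * qRe y + qIm2 x * qIm3 y - qIm3 x * qIm2 y"
| "qIm2 (x * y) = qRe x * qIm2 y - qIm1 x * qIm3 y + qIm2 x * qRe y + qIm3 x * qIm1 y"
| "qIm3 (x * y) = qRe x * qIm3 y + qIm1 x * qIm2 y - qIm2 x * qIm1 y + qIm3 x * qRe y"

instance
  by standard (simp_all add: quat_eq_iff algebra_simps)

end

primcorec qcnj :: "quat \<Rightarrow> quat" where
  "qRe (qcnj x) = qRe x"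
| "qIm1 (qcnj x) = - qIm1 x"
| "qIm2 (qcnj x) = - qIm2 x"
| "qIm3 (qcnj x) = - qIm3 x"

instantiation quat :: real_vector
begin

primcorec scaleR_quat where
  "qRe (scaleR r x) = r * qRe x"
| "qIm1 (scaleR r x) = r * qIm1 x"
| "qIm2 (scaleR r x) = r * qIm2 x"
| "qIm3 (scaleR r x) = r * qIm3 x"

instance
  by standard (simp_all add: quat_eq_iff algebra_simps)

end

instantiation quat :: real_inner
begin

definition inner_quat :: "quat \<Rightarrow> quat \<Rightarrow> real" where
  "inner_quat x y = qRe x * qRe y + qIm1 x * qIm1 y + qIm2 x * qIm2 y + qIm3 x * qIm3 y"

definition norm_quat :: "quat \<Rightarrow> real" where
  "norm_quat x = sqrt ((qRe x)\<^sup>2 + (qIm1 x)\<^sup>2 + (qIm2 x)\<^sup>2 + (qIm3 x)\<^sup>2)"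

definition sgn_quat :: "quat \<Rightarrow> quat" where
  "sgn_quat x = x /\<^sub>R norm x"

definition dist_quat :: "quat \<Rightarrow> quat \<Rightarrow> real" where
  "dist_quat x y = norm (x - y)"

definition uniformity_quat :: "(quat \<times> quat) filter" where
  "uniformity_quat = (INF e\<in>{0 <..}. principal {(x, y). dist x y < e})"

definition open_quat :: "quat set \<Rightarrow> bool" where
  "open_quat U \<longleftrightarrow> (\<forall>x\<in>U. eventually (\<lambda>(x', y). x' = x \<longrightarrow> y \<in> U) uniformity)"

instance
proof
  fix x y z :: quat and r :: real and U :: "quat set"
  show "dist x y = norm (x - y)" by (rule dist_quat_def)
  show "sgn x = x /\<^sub>R norm x" by (rule sgn_quat_def)
  show "uniformity = (INF e\<in>{0 <..}. principal {(x::quat, y). dist x y < e})"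
    by (rule uniformity_quat_def)
  show "open U \<longleftrightarrow> (\<forall>x\<in>U. eventually (\<lambda>(x', y). x' = x \<longrightarrow> y \<in> U) uniformity)"
    by (rule open_quat_def)
  show "inner x y = inner y x" "inner (x + y) z = inner x z + inner y z"
    "inner (r *\<^sub>R x) y = r * inner x y" "0 \<le> inner x x"
    by (simp_all add: inner_quat_def algebra_simps)
  show "inner x x = 0 \<longleftrightarrow> x = 0"
    by (auto simp: inner_quat_def quat_eq_iff add_nonneg_eq_0_iff)
  show "norm x = sqrt (inner x x)"
    by (simp add: norm_quat_def inner_quat_def power2_eq_square)
qed

end

instance quat :: real_normed_algebra_1
proof
  fix x y :: quat and r :: real
  show "r *\<^sub>R x * y = r *\<^sub>R (x * y)" "x * r *\<^sub>R y = r *\<^sub>R (x * y)"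
    by (simp_all add: quat_eq_iff algebra_simps)
  have "norm (x * y) = norm x * norm y"
    by (simp add: norm_quat_def real_sqrt_mult [symmetric] power2_eq_square algebra_simps)
  then show "norm (x * y) \<le> norm x * norm y" by simp
  show "norm (1::quat) = 1" by (simp add: norm_quat_def)
qed


section \<open>Right quaternionic Hilbert spaces\<close>

text \<open>
  The real scalar multiplication and the norm supplied by \<^class>\<open>banach\<close> are those induced by
  the quaternionic structure, so they are no additional data: \<open>scaleR_eq_scaleQ\<close> and
  \<open>qinner_self\<close> determine them. The latter also says that \<open>qinner x x\<close> is real,
  and positive for nonzero \<open>x\<close>.
\<close>

class right_quat_hilbert = banach +
  fixes scaleQ :: "'a \<Rightarrow> quat \<Rightarrow> 'a"  (infixl \<open>*\<^sub>H\<close> 75)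
    and qinner :: "'a \<Rightarrow> 'a \<Rightarrow> quat"
  assumes scaleQ_add_left: "(x + y) *\<^sub>H q = x *\<^sub>H q + y *\<^sub>H q"
    and scaleQ_add_right: "x *\<^sub>H (p + q) = x *\<^sub>H p + x *\<^sub>H q"
    and scaleQ_mult: "x *\<^sub>H (p * q) = (x *\<^sub>H p) *\<^sub>H q"
    and scaleQ_one: "x *\<^sub>H 1 = x"
    and scaleR_eq_scaleQ: "r *\<^sub>R x = x *\<^sub>H of_real r"
    and qcnj_qinner: "qcnj (qinner x y) = qinner y x"
    and qinner_add_right: "qinner x (y + z) = qinner x y + qinner x z"
    and qinner_scaleQ_right: "qinner x (y *\<^sub>H q) = qinner x y * q"
    and qinner_scaleQ_left: "qinner (x *\<^sub>H q) y = qcnj q * qinner x y"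
    and qinner_self: "qinner x x = of_real ((norm x)\<^sup>2)"
    and separable: "\<exists>D. countable D \<and> (\<forall>U. open U \<longrightarrow> U \<noteq> {} \<longrightarrow> D \<inter> U \<noteq> {})"


section \<open>Semi-regular operators and the Kato S-spectrum\<close>

definition bounded_right_ops :: "('v::right_quat_hilbert \<Rightarrow> 'v) set" where
  "bounded_right_ops = {A. bounded_linear A \<and> (\<forall>x q. A (x *\<^sub>H q) = A x *\<^sub>H q)}"

definition ker :: "('v::right_quat_hilbert \<Rightarrow> 'v) \<Rightarrow> 'v set" where
  "ker A = {x. A x = 0}"

definition hyperrange :: "('v::right_quat_hilbert \<Rightarrow> 'v) \<Rightarrow> 'v set" where
  "hyperrange B = (\<Inter>n. range (B ^^ n))"

definition semi_regular :: "('v::right_quat_hilbert \<Rightarrow> 'v) \<Rightarrow> bool" where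
  "semi_regular B \<longleftrightarrow>
     B \<in> bounded_right_ops \<and> closed (range B) \<and> ker B \<subseteq> hyperrange B"

definition R_op :: "quat \<Rightarrow> ('v::right_quat_hilbert \<Rightarrow> 'v) \<Rightarrow> 'v \<Rightarrow> 'v" where
  "R_op q A = (\<lambda>x. (A ^^ 2) x - (2 * qRe q) *\<^sub>R A x + (norm q)\<^sup>2 *\<^sub>R x)"

definition kato_S_resolvent_set :: "('v::right_quat_hilbert \<Rightarrow> 'v) \<Rightarrow> quat set" where
  "kato_S_resolvent_set A = {q. semi_regular (R_op q A)}"

definition kato_S_spectrum :: "('v::right_quat_hilbert \<Rightarrow> 'v) \<Rightarrow> quat set" where
  "kato_S_spectrum A = - kato_S_resolvent_set A"

definition reduced_min_modulus :: "('v::right_quat_hilbert \<Rightarrow> 'v) \<Rightarrow> ereal" where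
  "reduced_min_modulus A =
     (if A = (\<lambda>x. 0) then \<infinity>
      else (INF x\<in>- ker A. ereal (norm (A x) / infdist x (ker A))))"

definition beta :: "quat \<Rightarrow> real" where
  "beta q = \<bar>qRe q\<bar> + sqrt (\<bar>qRe q\<bar>\<^sup>2 + (norm q)\<^sup>2)"

end

theory Submission
  imports Defs
begin

text \<open>
  Semi-regularity of \<open>T\<close> is a splitting property relative to one closed subspace. If \<open>T\<close> is
  semi-regular, then \<open>M = hyperrange T\<close> is closed, \<open>T\<close> maps \<open>M\<close> onto \<open>M\<close>, and the map that \<open>T\<close>
  induces on the quotient by \<open>M\<close> is bounded below; both estimates hold with the same constant \<open>c\<close>,
  which can be any positive constant below the reduced minimum modulus (\<open>semi_regular_hyperrange\<close>).
  Conversely, a closed \<open>T\<close>-invariant subspace \<open>M\<close> such that \<open>T\<close> maps \<open>M\<close> onto itself and is bounded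
  below modulo \<open>M\<close> forces \<open>T\<close> to be semi-regular (\<open>semi_regularI_invariant_subspace\<close>): the kernel
  lies in \<open>M\<close>, and \<open>M = (T ^^ n) ` M\<close> lies in every \<open>range (T ^^ n)\<close>. The quotient never appears as
  a space; its norm is the seminorm \<open>\<lambda>x. infdist x M\<close>. Surjectivity is only demanded up to a relative
  error \<open>\<theta> < 1\<close>, since a geometric series removes the error. In this form both conditions are stable
  under small perturbations that leave \<open>M\<close> invariant, and the three claims are three instances.

  For the first claim take \<open>M = hyperrange A\<close>. On \<open>M\<close> one solves \<open>A (A x) = y\<close> with
  \<open>norm x \<le> norm y / c\<^sup>2\<close> and \<open>norm (A x) \<le> norm y / c\<close>; with \<open>a = 2 * \<bar>qRe q\<bar>\<close> and \<open>b = (norm q)\<^sup>2\<close>,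
  the lower-order terms of \<open>R_op q A\<close> produce a relative error \<open>(a * c + b) / c\<^sup>2\<close>. The lower bound on
  the quotient is \<open>c\<^sup>2 - a * c - b\<close>. Both requirements say \<open>a * c + b < c\<^sup>2\<close>, and \<open>beta q\<close> is precisely
  the larger root of \<open>c\<^sup>2 = a * c + b\<close>.

  For openness at \<open>p\<close> take \<open>M = hyperrange (R_op p A)\<close>. It is invariant under \<open>A\<close>, because \<open>A\<close> commutes
  with \<open>R_op p A\<close>, hence under every \<open>R_op q A\<close>; and \<open>R_op q A\<close> tends to \<open>R_op p A\<close> in norm as \<open>q\<close>
  tends to \<open>p\<close>. A positive constant \<open>c\<close> for \<open>R_op p A\<close> comes from the open mapping theorem, applied to an
  operator with closed range. For compactness it remains to bound the spectrum, and for large \<open>norm q\<close>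
  one takes for \<open>M\<close> the whole space: \<open>R_op q A\<close> is then a small perturbation of a multiple of the
  identity.
\<close>

section \<open>Operators with closed range\<close>

text \<open>
  Solving up to the error \<open>\<theta>\<close>, then solving for the residual, and so on, produces corrections that
  decay like \<open>\<theta> ^ n\<close>; their sum is an exact solution. With \<open>Y\<close> the range of \<open>T\<close> this bounds
  preimages; with \<open>Y\<close> the closure of the range it shows that the range is closed.
\<close>

lemma approximate_lifting_exact:
  fixes T :: "'a::banach \<Rightarrow> 'b::real_normed_vector"
  assumes T: "bounded_linear T" and X: "subspace X" "closed X" and Y: "subspace Y"
    and TX: "T ` X \<subseteq> Y" and K: "0 \<le> K" and \<theta>: "0 \<le> \<theta>" "\<theta> < 1"
    and approx: "\<And>y. y \<in> Y \<Longrightarrow> \<exists>x\<in>X. norm x \<le> K * norm y \<and> norm (T x - y) \<le> \<theta> * norm y"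
    and y: "y \<in> Y"
  shows "\<exists>x\<in>X. T x = y \<and> norm x \<le> K / (1 - \<theta>) * norm y"
proof -
  interpret T: bounded_linear T by (rule T)
  obtain f where f: "\<And>y. y \<in> Y \<Longrightarrow> f y \<in> X" "\<And>y. y \<in> Y \<Longrightarrow> norm (f y) \<le> K * norm y"
      "\<And>y. y \<in> Y \<Longrightarrow> norm (T (f y) - y) \<le> \<theta> * norm y"
    using approx by metis
  \<comment> \<open>\<open>r n\<close> is the residual after \<open>n\<close> corrections\<close>
  define r where "r n = ((\<lambda>y. y - T (f y)) ^^ n) y" for n
  have r0: "r 0 = y" and rS: "r (Suc n) = r n - T (f (r n))" for n
    by (simp_all add: r_def)
  have rY: "r n \<in> Y" for n
    by (induction n) (use y f(1) TX in \<open>auto simp: r0 rS intro!: subspace_diff[OF Y]\<close>)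
  have r_norm: "norm (r n) \<le> \<theta> ^ n * norm y" for n
  proof (induction n)
    case (Suc n)
    have "norm (r (Suc n)) \<le> \<theta> * norm (r n)"
      using f(3)[OF rY, of n] by (simp add: rS norm_minus_commute)
    also have "\<dots> \<le> \<theta> * (\<theta> ^ n * norm y)"
      using Suc \<theta> by (intro mult_left_mono) auto
    finally show ?case by (simp add: mult.assoc)
  qed (simp add: r0)
  have f_norm: "norm (f (r n)) \<le> K * norm y * \<theta> ^ n" for n
  proof -
    have "norm (f (r n)) \<le> K * norm (r n)" by (rule f(2)[OF rY])
    also have "\<dots> \<le> K * (\<theta> ^ n * norm y)"
      using r_norm K by (intro mult_left_mono) auto
    finally show ?thesis by (simp add: mult_ac)
  qed
  have geom: "(\<lambda>n. K * norm y * \<theta> ^ n) sums (K * norm y * (1 / (1 - \<theta>)))"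
    using \<theta> by (intro sums_mult geometric_sums) auto
  have summ: "summable (\<lambda>n. f (r n))"
    using sums_summable[OF geom] f_norm by (rule summable_comparison_test')
  define x where "x = (\<Sum>n. f (r n))"
  have x: "(\<lambda>n. f (r n)) sums x"
    unfolding x_def using summ by (rule summable_sums)
  have "x \<in> X"
  proof (rule Lim_in_closed_set[OF X(2)])
    show "(\<lambda>n. \<Sum>k<n. f (r k)) \<longlonglongrightarrow> x" using x by (simp add: sums_def)
    show "\<forall>\<^sub>F n in sequentially. (\<Sum>k<n. f (r k)) \<in> X"
      using f(1) rY X(1) by (auto intro!: always_eventually subspace_sum)
  qed simp
  moreover have "T x = y"
  proof -
    have "(\<lambda>n. T (f (r n))) sums T x"
      using x by (rule T.sums)
    moreover have "(\<lambda>n. T (f (r n))) sums y"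
    proof -
      have "(\<lambda>n. \<theta> ^ n * norm y) \<longlonglongrightarrow> 0"
        using \<theta> by (intro tendsto_mult_left_zero LIMSEQ_power_zero) auto
      then have "r \<longlonglongrightarrow> 0"
        by (rule Lim_null_comparison[rotated]) (simp add: r_norm)
      from telescope_sums'[OF this] show ?thesis by (simp add: rS r0)
    qed
    ultimately show ?thesis by (rule sums_unique2)
  qed
  moreover have "norm x \<le> K / (1 - \<theta>) * norm y"
    using norm_sums_le[OF x geom f_norm] by (simp add: mult_ac)
  ultimately show ?thesis by blast
qed

text \<open>
  For linear \<open>T\<close> and positive \<open>c\<close> this is openness of \<open>T\<close> onto its range, in quantitative form. It
  differs from \<open>c \<le> \<gamma>(T)\<close>, for the reduced minimum modulus \<open>\<gamma>\<close>, in that the distance to the kernel is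
  bounded through an element that realises the estimate, so that no limit is needed to use it.
\<close>

definition lifts_with :: "real \<Rightarrow> ('a::real_normed_vector \<Rightarrow> 'b::real_normed_vector) \<Rightarrow> bool" where
  "lifts_with c T \<longleftrightarrow> (\<forall>x. \<exists>x'. T x' = T x \<and> c * norm x' \<le> norm (T x))"

text \<open>
  The open mapping theorem for \<open>T\<close> onto its range. The range is covered by the closures of the images
  of the balls \<open>ball 0 n\<close>, so by Baire one closure has interior points relative to the range. Differences
  of points near an interior point then solve \<open>T x = y\<close> up to half of \<open>norm y\<close>.
\<close>

lemma closed_range_imp_lifts_with:
  fixes T :: "'a::banach \<Rightarrow> 'b::banach"
  assumes T: "bounded_linear T" and cl: "closed (range T)"
  obtains c where "0 < c" "lifts_with c T"
proof -
  interpret T: bounded_linear T by (rule T)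
  define X where "X = top_of_set (range T)"
  define F where "F n = closure (T ` ball 0 (real n))" for n
  have sub: "subspace (range T)"
    using T.linear_axioms by (simp add: linear_subspace_image)
  have F_sub: "F n \<subseteq> range T" for n
    unfolding F_def using cl by (intro closure_minimal) auto
  have F_closed: "closedin (top_of_set (range T)) (F n)" for n
    using F_sub[of n] by (intro closed_subset) (auto simp: F_def)
  have "\<exists>n. X interior_of F n \<noteq> {}"
  proof (rule ccontr)
    assume "\<not> ?thesis"
    then have "X interior_of \<Union>(range F) = {}"
      using cl F_closed unfolding X_def
      by (intro Baire_category_alt disjI1 completely_metrizable_space_closedin
            [OF completely_metrizable_space_euclidean]) auto
    moreover have "\<Union>(range F) = range T"
    proof
      show "range T \<subseteq> \<Union>(range F)"
      proof (clarify)
        fix x :: 'a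
        obtain n where "norm x < real n" using reals_Archimedean2 by blast
        then have "T x \<in> T ` ball 0 (real n)" by simp
        then have "T x \<in> F n" unfolding F_def by (rule subsetD[OF closure_subset])
        then show "T x \<in> \<Union>(range F)" by blast
      qed
    qed (use F_sub in auto)
    ultimately show False
      using interior_of_topspace[of X] unfolding X_def by simp
  qed
  then obtain n y0 where "y0 \<in> X interior_of F n" by blast
  then obtain V where V: "openin X V" "y0 \<in> V" "V \<subseteq> F n"
    unfolding interior_of_def by blast
  then obtain U where "open U" "V = range T \<inter> U"
    unfolding X_def openin_open by blast
  with V have U: "open U" "y0 \<in> U" "y0 \<in> range T" "U \<inter> range T \<subseteq> F n"
    by auto
  then obtain e where e: "0 < e" "ball y0 e \<subseteq> U"
    by (meson open_contains_ball)
  define K where "K = 4 * (real n + 1) / e"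
  have K: "0 < K" unfolding K_def using e by simp
  have approx: "\<exists>x\<in>UNIV. norm x \<le> K * norm y \<and> norm (T x - y) \<le> 1/2 * norm y"
    if y: "y \<in> range T" for y
  proof (cases "y = 0")
    case True
    then show ?thesis by (intro bexI[of _ 0]) (auto simp: T.zero)
  next
    case False
    \<comment> \<open>scaling by \<open>s\<close> brings \<open>y0 + s *\<^sub>R y\<close> into the ball around the interior point \<open>y0\<close>\<close>
    define s where "s = e / (2 * norm y)"
    have s: "0 < s" "s * norm y = e / 2" using False e by (auto simp: s_def)
    have near: "\<exists>u. norm u < real n \<and> norm (T u - z) < e / 8" if z: "z \<in> F n" for z
    proof -
      have "\<exists>w\<in>T ` ball 0 (real n). dist z w < e / 8"
        using z e unfolding F_def by (intro closure_approachableD) auto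
      then show ?thesis by (auto simp: dist_norm norm_minus_commute)
    qed
    have "y0 \<in> F n" using U by auto
    then obtain u where u: "norm u < real n" "norm (T u - y0) < e / 8" using near by blast
    have "y0 + s *\<^sub>R y \<in> ball y0 e" using s e by (simp add: dist_norm)
    moreover have "y0 + s *\<^sub>R y \<in> range T"
      using U(3) y sub by (intro subspace_add subspace_scale) auto
    ultimately have "y0 + s *\<^sub>R y \<in> F n" using U(4) e(2) by blast
    then obtain v where v: "norm v < real n" "norm (T v - (y0 + s *\<^sub>R y)) < e / 8"
      using near by blast
    define x where "x = (v - u) /\<^sub>R s"
    have "norm (v - u) \<le> 2 * (real n + 1)"
      using norm_triangle_ineq4[of v u] u v by simp
    then have "norm x \<le> 2 * (real n + 1) / s"
      using s(1) by (simp add: x_def divide_inverse_commute)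
    also have "\<dots> = K * norm y" using False e by (simp add: s_def K_def)
    finally have 1: "norm x \<le> K * norm y" .
    have "T x - y = ((T v - (y0 + s *\<^sub>R y)) - (T u - y0)) /\<^sub>R s"
      using s(1) by (simp add: x_def T.scaleR T.diff scaleR_diff_right scaleR_add_right)
    then have "norm (T x - y) = norm ((T v - (y0 + s *\<^sub>R y)) - (T u - y0)) / s"
      using s(1) by (simp add: divide_inverse_commute)
    also have "\<dots> \<le> (e / 4) / s"
      using norm_triangle_ineq4[of "T v - (y0 + s *\<^sub>R y)" "T u - y0"] u(2) v(2) s(1)
      by (intro divide_right_mono) linarith+
    also have "\<dots> = 1/2 * norm y" using False e by (simp add: s_def)
    finally show ?thesis using 1 by blast
  qed
  define c where "c = 1 / (K / (1 - 1/2))"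
  have "0 < c" using K by (simp add: c_def)
  moreover have "lifts_with c T" unfolding lifts_with_def
  proof
    fix x
    have "\<exists>x'\<in>UNIV. T x' = T x \<and> norm x' \<le> K / (1 - 1/2) * norm (T x)"
      by (rule approximate_lifting_exact[OF T subspace_UNIV closed_UNIV sub _ _ _ _ approx])
        (use K in simp_all)
    then obtain x' where "T x' = T x" "norm x' \<le> K / (1 - 1/2) * norm (T x)" by blast
    then show "\<exists>x'. T x' = T x \<and> c * norm x' \<le> norm (T x)"
      using K by (intro exI[of _ x']) (auto simp: c_def field_simps)
  qed
  ultimately show ?thesis using that by blast
qed

lemma subspace_closure:
  fixes S :: "'a::real_normed_vector set"
  assumes "subspace S"
  shows "subspace (closure S)"
  unfolding subspace_def
proof (intro conjI allI ballI)
  show "0 \<in> closure S" using subspace_0[OF assms] by (rule subsetD[OF closure_subset])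
  fix x assume "x \<in> closure S"
  then obtain f where f: "\<And>n. f n \<in> S" "f \<longlonglongrightarrow> x" unfolding closure_sequential by blast
  show "r *\<^sub>R x \<in> closure S" for r
    unfolding closure_sequential using f assms
    by (intro exI[of _ "\<lambda>n. r *\<^sub>R f n"]) (auto intro!: subspace_scale tendsto_intros)
  fix y assume "y \<in> closure S"
  then obtain g where g: "\<And>n. g n \<in> S" "g \<longlonglongrightarrow> y" unfolding closure_sequential by blast
  show "x + y \<in> closure S"
    unfolding closure_sequential using f g assms
    by (intro exI[of _ "\<lambda>n. f n + g n"]) (auto intro!: subspace_add tendsto_intros)
qed

text \<open>
  A point of the closure of the range lies close to some \<open>T x\<close>, and \<open>T x\<close> has a preimage of controlled
  norm; this solves the equation approximately on the whole closure, hence exactly.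
\<close>

lemma lifts_with_imp_closed_range:
  fixes T :: "'a::banach \<Rightarrow> 'b::real_normed_vector"
  assumes T: "bounded_linear T" and c: "0 < c" "lifts_with c T"
  shows "closed (range T)"
proof -
  interpret T: bounded_linear T by (rule T)
  have sub: "subspace (closure (range T))"
    using T.linear_axioms by (simp add: linear_subspace_image subspace_closure)
  have approx: "\<exists>x\<in>UNIV. norm x \<le> 2 / c * norm y \<and> norm (T x - y) \<le> 1/2 * norm y"
    if y: "y \<in> closure (range T)" for y
  proof (cases "y = 0")
    case True
    then show ?thesis by (intro bexI[of _ 0]) (auto simp: T.zero)
  next
    case False
    then obtain x where x: "norm (T x - y) < 1/2 * norm y"
      using y closure_approachableD[of y "range T" "1/2 * norm y"]
      by (auto simp: dist_norm norm_minus_commute)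
    obtain x' where x': "T x' = T x" "c * norm x' \<le> norm (T x)"
      using c(2) unfolding lifts_with_def by blast
    have "norm (T x) \<le> 2 * norm y"
      using norm_triangle_sub[of "T x" y] x norm_ge_zero[of y] by linarith
    then have "norm x' \<le> 2 / c * norm y" using x'(2) c(1) by (simp add: field_simps)
    then show ?thesis using x x'(1) by (intro bexI[of _ x']) auto
  qed
  have "closure (range T) \<subseteq> range T"
  proof
    fix y assume y: "y \<in> closure (range T)"
    have "\<exists>x\<in>UNIV. T x = y \<and> norm x \<le> 2 / c / (1 - 1/2) * norm y"
      by (rule approximate_lifting_exact[OF T subspace_UNIV closed_UNIV sub _ _ _ _ approx y])
        (use c(1) closure_subset[of "range T"] in simp_all)
    then show "y \<in> range T" by auto
  qed
  then show ?thesis using closure_subset_eq by blast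
qed

section \<open>The quotient seminorm of a subspace\<close>

lemma infdist_subspace_near:
  fixes M :: "'a::real_normed_vector set"
  assumes "subspace M" "0 < e"
  obtains m where "m \<in> M" "dist x m < infdist x M + e"
proof -
  have "M \<noteq> {}" using assms(1) subspace_0 by blast
  then have "(INF a\<in>M. dist x a) < infdist x M + e"
    using assms(2) by (simp add: infdist_notempty)
  then show ?thesis
    using that \<open>M \<noteq> {}\<close> by (subst (asm) cINF_less_iff) (auto intro: bdd_belowI[of _ 0])
qed

lemma infdist_subspace_add:
  fixes M :: "'a::real_normed_vector set"
  assumes M: "subspace M"
  shows "infdist (x + y) M \<le> infdist x M + infdist y M"
proof (rule field_le_epsilon)
  fix e :: real assume e: "0 < e"
  obtain m where m: "m \<in> M" "dist x m < infdist x M + e/2"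
    by (rule infdist_subspace_near[OF M half_gt_zero[OF e]])
  obtain n where n: "n \<in> M" "dist y n < infdist y M + e/2"
    by (rule infdist_subspace_near[OF M half_gt_zero[OF e]])
  have "infdist (x + y) M \<le> dist (x + y) (m + n)"
    using M m(1) n(1) by (intro infdist_le subspace_add)
  also have "\<dots> \<le> dist x m + dist y n"
    using norm_triangle_ineq[of "x - m" "y - n"] by (simp add: dist_norm algebra_simps)
  finally show "infdist (x + y) M \<le> infdist x M + infdist y M + e" using m n by linarith
qed

text \<open>
  An operator that leaves \<open>M\<close> invariant induces one on the quotient by \<open>M\<close>, of no larger norm.
\<close>

lemma infdist_invariant_subspace_le:
  fixes S :: "'a::real_normed_vector \<Rightarrow> 'a"
  assumes M: "subspace M" and S: "linear S" "\<And>x. x \<in> M \<Longrightarrow> S x \<in> M"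
    and bound: "\<And>x. norm (S x) \<le> K * norm x" and K: "0 \<le> K"
  shows "infdist (S x) M \<le> K * infdist x M"
proof (rule field_le_epsilon)
  fix e :: real assume e: "0 < e"
  obtain m where m: "m \<in> M" "dist x m < infdist x M + e / (K + 1)"
    using infdist_subspace_near[OF M, of "e / (K + 1)"] e K by auto
  have "infdist (S x) M \<le> dist (S x) (S m)" using S(2) m(1) by (intro infdist_le)
  also have "\<dots> = norm (S (x - m))" by (simp add: dist_norm linear_diff[OF S(1)])
  also have "\<dots> \<le> K * dist x m" unfolding dist_norm by (rule bound)
  also have "\<dots> \<le> K * (infdist x M + e / (K + 1))"
    using m(2) K by (intro mult_left_mono) auto
  also have "\<dots> \<le> K * infdist x M + e" using e K by (simp add: field_simps)
  finally show "infdist (S x) M \<le> K * infdist x M + e" .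
qed

lemma infdist_subspace_scaleR:
  fixes M :: "'a::real_normed_vector set"
  assumes "subspace M"
  shows "infdist (r *\<^sub>R x) M \<le> \<bar>r\<bar> * infdist x M"
  using assms by (intro infdist_invariant_subspace_le)
    (auto intro: subspace_scale linearI simp: algebra_simps)

section \<open>Semi-regularity through an invariant subspace\<close>

lemma bounded_right_opsD: "T \<in> bounded_right_ops \<Longrightarrow> bounded_linear T"
  by (simp add: bounded_right_ops_def)

lemma bounded_linear_funpow:
  assumes "bounded_linear (T :: 'a::real_normed_vector \<Rightarrow> 'a)"
  shows "bounded_linear (T ^^ n)"
proof (induction n)
  case (Suc n)
  then show ?case using bounded_linear_compose[OF assms] by (simp add: o_def)
qed (simp add: id_def bounded_linear_ident)

lemma subspace_hyperrange:
  assumes "bounded_linear (T :: 'v::right_quat_hilbert \<Rightarrow> 'v)"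
  shows "subspace (hyperrange T)"
proof -
  have "subspace (range (T ^^ n))" for n
    using bounded_linear.linear[OF bounded_linear_funpow[OF assms]]
    by (intro linear_subspace_image) auto
  then show ?thesis unfolding hyperrange_def by (intro subspace_Inter) auto
qed

text \<open>
  The lower bound modulo \<open>M\<close> places the kernel in \<open>M\<close>, and \<open>M = T ` M\<close> places \<open>M\<close> in the hyperrange.
  For the closed range, a given \<open>x\<close> is replaced by a short vector with the same image: \<open>x - m\<close> is short
  for a suitable \<open>m\<close> in \<open>M\<close> by the lower bound, and \<open>T m\<close>, which is then under control, has a short
  preimage \<open>m'\<close> in \<open>M\<close>.
\<close>

lemma semi_regularI_invariant_subspace:
  fixes T :: "'v::right_quat_hilbert \<Rightarrow> 'v"
  assumes T: "T \<in> bounded_right_ops" and M: "subspace M" "closed M"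
    and inv: "\<And>x. x \<in> M \<Longrightarrow> T x \<in> M"
    and K: "0 \<le> K" and \<theta>: "0 \<le> \<theta>" "\<theta> < 1"
    and approx: "\<And>y. y \<in> M \<Longrightarrow> \<exists>x\<in>M. norm x \<le> K * norm y \<and> norm (T x - y) \<le> \<theta> * norm y"
    and c: "0 < c" "\<And>x. c * infdist x M \<le> infdist (T x) M"
  shows "semi_regular T"
proof -
  have lin: "bounded_linear T" using T by (rule bounded_right_opsD)
  interpret T: bounded_linear T by (rule lin)
  define L where "L = K / (1 - \<theta>)"
  have L: "0 \<le> L" using K \<theta> by (simp add: L_def)
  have onto: "\<exists>x\<in>M. T x = y \<and> norm x \<le> L * norm y" if "y \<in> M" for y
    unfolding L_def
    by (rule approximate_lifting_exact[OF lin M M(1) _ K \<theta> approx that]) (use inv in auto)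
  have M_range: "M \<subseteq> range (T ^^ n)" for n
  proof (induction n)
    case (Suc n)
    show ?case
    proof
      fix y assume "y \<in> M"
      then obtain x where "x \<in> M" "T x = y" using onto by blast
      then show "y \<in> range (T ^^ Suc n)" using Suc by auto
    qed
  qed simp
  have "ker T \<subseteq> M"
  proof
    fix x assume "x \<in> ker T"
    then have "c * infdist x M \<le> 0"
      using c(2)[of x] subspace_0[OF M(1)] by (simp add: ker_def)
    then have "infdist x M = 0"
      using c(1) infdist_nonneg[of x M] by (simp add: mult_le_0_iff)
    then show "x \<in> M"
      using in_closed_iff_infdist_zero[OF M(2)] subspace_0[OF M(1)] by blast
  qed
  moreover have "closed (range T)"
  proof -
    obtain B where B: "0 \<le> B" "\<And>x. norm (T x) \<le> B * norm x"
      using T.nonneg_bounded by (auto simp: mult.commute)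
    \<comment> \<open>the bound for \<open>x - m\<close> plus the bound for \<open>m'\<close>\<close>
    define C where "C = 2 / c + L * (1 + B * (2 / c))"
    have C: "0 < C" using c B L by (auto simp: C_def intro!: add_pos_nonneg)
    have "lifts_with (1 / C) T"
      unfolding lifts_with_def
    proof
      fix x
      show "\<exists>x'. T x' = T x \<and> 1 / C * norm x' \<le> norm (T x)"
      proof (cases "T x = 0")
        case True
        then show ?thesis by (intro exI[of _ 0]) (simp add: T.zero)
      next
        case False
        obtain m where m: "m \<in> M" "dist x m < infdist x M + norm (T x) / c"
          using infdist_subspace_near[OF M(1), of "norm (T x) / c"] False c by auto
        have "infdist (T x) M \<le> norm (T x)"
          using infdist_le[OF subspace_0[OF M(1)], of "T x"] by simp
        then have "infdist x M \<le> norm (T x) / c"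
          using c(2)[of x] c(1) by (simp add: field_simps)
        then have u: "norm (x - m) \<le> 2 / c * norm (T x)"
          using m(2) by (simp add: dist_norm)
        have "norm (T m) \<le> norm (T x) + norm (T (x - m))"
          using norm_triangle_ineq4[of "T x" "T (x - m)"] by (simp add: T.diff)
        also have "norm (T (x - m)) \<le> B * (2 / c * norm (T x))"
          using B(2)[of "x - m"] mult_left_mono[OF u B(1)] by linarith
        finally have Tm: "norm (T m) \<le> (1 + B * (2 / c)) * norm (T x)"
          by (simp add: algebra_simps)
        obtain m' where m': "m' \<in> M" "T m' = T m" "norm m' \<le> L * norm (T m)"
          using onto[OF inv[OF m(1)]] by blast
        have "norm (x - m + m') \<le> norm (x - m) + norm m'" by (rule norm_triangle_ineq)
        also have "\<dots> \<le> 2 / c * norm (T x) + L * ((1 + B * (2 / c)) * norm (T x))"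
          using u m'(3) mult_left_mono[OF Tm L] by linarith
        also have "\<dots> \<le> C * norm (T x)"
          by (simp add: C_def algebra_simps)
        finally show ?thesis
          using C m'(2) by (intro exI[of _ "x - m + m'"]) (simp add: T.add T.diff field_simps)
      qed
    qed
    then show ?thesis using C by (intro lifts_with_imp_closed_range[OF lin, of "1 / C"]) auto
  qed
  ultimately show ?thesis
    using T M_range unfolding semi_regular_def hyperrange_def by blast
qed

text \<open>
  Since \<open>N\<close> contains the kernel, membership in \<open>N\<close> does not depend on the choice of the preimage. A
  preimage \<open>x\<close> of the limit can therefore be approximated by points of \<open>N\<close>, and \<open>N\<close> is closed.
\<close>

lemma closed_image_subspace:
  fixes T :: "'a::real_normed_vector \<Rightarrow> 'b::real_normed_vector"
  assumes T: "bounded_linear T" and range: "closed (range T)"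
    and c: "0 < c" "lifts_with c T"
    and N: "subspace N" "closed N" "\<And>x. T x = 0 \<Longrightarrow> x \<in> N"
  shows "closed (T ` N)"
  unfolding closed_sequential_limits
proof (intro allI impI, elim conjE)
  interpret T: bounded_linear T by (rule T)
  fix y l assume y: "\<forall>n. y n \<in> T ` N" and lim: "y \<longlonglongrightarrow> l"
  have "l \<in> range T"
    by (rule closed_sequentially[OF range _ lim]) (use y in auto)
  then obtain x where x: "l = T x" by blast
  obtain u where u: "\<And>n. u n \<in> N" "\<And>n. y n = T (u n)" using y unfolding image_iff by metis
  have "\<exists>v. v \<in> N \<and> c * norm (x - v) \<le> norm (l - y n)" for n
  proof -
    obtain w where w: "T w = T (x - u n)" "c * norm w \<le> norm (T (x - u n))"
      using c(2) unfolding lifts_with_def by blast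
    have "x - u n - w \<in> N" using w(1) by (intro N(3)) (simp add: T.diff)
    then have "u n + (x - u n - w) \<in> N" using u(1) N(1) by (intro subspace_add)
    then show ?thesis using w by (intro exI[of _ "x - w"]) (simp add: T.diff x u(2))
  qed
  then obtain v where v: "\<And>n. v n \<in> N" "\<And>n. c * norm (x - v n) \<le> norm (l - y n)" by metis
  have "(\<lambda>n. norm (l - y n) / c) \<longlonglongrightarrow> 0"
    using tendsto_divide[OF tendsto_norm[OF tendsto_diff[OF tendsto_const lim, of l]] tendsto_const, of c] c(1)
    by simp
  then have "(\<lambda>n. v n - x) \<longlonglongrightarrow> 0"
    by (rule Lim_null_comparison[rotated])
      (use v(2) c(1) in \<open>auto simp: norm_minus_commute field_simps\<close>)
  then have "v \<longlonglongrightarrow> x" by (simp add: LIM_zero_iff)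
  then have "x \<in> N" by (rule closed_sequentially[OF N(2) v(1)])
  then show "l \<in> T ` N" using x by blast
qed

text \<open>
  The hyperrange contains the kernel, so it contains every preimage of its elements: such a preimage
  differs from one in \<open>range (T ^^ n)\<close> by an element of the kernel. This yields the preimages within the
  hyperrange, and also the lower bound, since every element of the hyperrange subtracted from \<open>T x\<close>
  is the image of one that can be subtracted from \<open>x\<close>. That each \<open>range (T ^^ n)\<close> is closed follows by induction, as it contains the kernel.
\<close>

lemma semi_regular_hyperrange:
  fixes T :: "'v::right_quat_hilbert \<Rightarrow> 'v"
  assumes sr: "semi_regular T" and c: "0 < c" "lifts_with c T"
  shows closed_hyperrange: "closed (hyperrange T)"
    and hyperrange_invariant: "\<And>x. x \<in> hyperrange T \<Longrightarrow> T x \<in> hyperrange T"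
    and hyperrange_lift: "\<And>y. y \<in> hyperrange T \<Longrightarrow> \<exists>x\<in>hyperrange T. T x = y \<and> c * norm x \<le> norm y"
    and hyperrange_quotient_bound:
      "\<And>x. c * infdist x (hyperrange T) \<le> infdist (T x) (hyperrange T)"
proof -
  have T: "bounded_linear T" and cl: "closed (range T)" and ker: "\<And>x. T x = 0 \<Longrightarrow> x \<in> hyperrange T"
    using sr by (auto simp: semi_regular_def ker_def dest: bounded_right_opsD)
  interpret T: bounded_linear T by (rule T)
  define M where "M = hyperrange T"
  have M: "subspace M" unfolding M_def using T by (rule subspace_hyperrange)
  have M_iff: "x \<in> M \<longleftrightarrow> (\<forall>n. x \<in> range (T ^^ n))" for x by (auto simp: M_def hyperrange_def)
  have "closed (range (T ^^ n))" for n
  proof (induction n)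
    case (Suc n)
    have "range (T ^^ Suc n) = T ` range (T ^^ n)" by (simp add: image_comp)
    moreover have "closed (T ` range (T ^^ n))"
      using Suc ker bounded_linear.linear[OF bounded_linear_funpow[OF T, of n]]
      by (intro closed_image_subspace[OF T cl c]) (auto simp: linear_subspace_image hyperrange_def)
    ultimately show ?case by metis
  qed simp
  then show "closed (hyperrange T)" unfolding hyperrange_def by blast
  show "T x \<in> hyperrange T" if x: "x \<in> hyperrange T" for x
  proof -
    have "T x \<in> range (T ^^ n)" for n
    proof -
      obtain u where "x = (T ^^ n) u" using x by (auto simp: hyperrange_def)
      then have "T x = (T ^^ n) (T u)" by (simp add: funpow_swap1)
      then show ?thesis by blast
    qed
    then show ?thesis by (auto simp: hyperrange_def)
  qed
  have lift: "\<exists>x\<in>M. T x = y \<and> c * norm x \<le> norm y" if y: "y \<in> M" for y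
  proof -
    have "y \<in> range (T ^^ Suc 0)" using y unfolding M_iff by blast
    then obtain u where u: "y = T u" by auto
    obtain x where x: "T x = y" "c * norm x \<le> norm y"
      using c(2) u unfolding lifts_with_def by blast
    have "x \<in> range (T ^^ n)" for n
    proof -
      obtain v where "y = (T ^^ Suc n) v" using y unfolding M_iff by blast
      then have "T (x - (T ^^ n) v) = 0" using x(1) by (simp add: T.diff)
      then have "x - (T ^^ n) v \<in> range (T ^^ n)" using ker by (auto simp: hyperrange_def)
      then have "x - (T ^^ n) v + (T ^^ n) v \<in> range (T ^^ n)"
        using bounded_linear.linear[OF bounded_linear_funpow[OF T, of n]]
        by (intro subspace_add) (auto simp: linear_subspace_image)
      then show ?thesis by simp
    qed
    then show ?thesis using x M_iff by blast
  qed
  then show "\<exists>x\<in>hyperrange T. T x = y \<and> c * norm x \<le> norm y" if "y \<in> hyperrange T" for y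
    using that M_def by blast
  have "c * infdist x M \<le> infdist (T x) M" for x
  proof (rule field_le_epsilon)
    fix e :: real assume "0 < e"
    then obtain m where m: "m \<in> M" "dist (T x) m < infdist (T x) M + e"
      using infdist_subspace_near[OF M] by blast
    obtain n where n: "n \<in> M" "T n = m" using lift m(1) by blast
    obtain w where w: "T w = T (x - n)" "c * norm w \<le> norm (T (x - n))"
      using c(2) unfolding lifts_with_def by blast
    have "x - n - w \<in> M" unfolding M_def using w(1) by (intro ker) (simp add: T.diff)
    then have "x - w \<in> M" using subspace_add[OF M n(1), of "x - n - w"] by simp
    then have "infdist x M \<le> norm w" using infdist_le[of "x - w" M x] by (simp add: dist_norm)
    then have "c * infdist x M \<le> c * norm w" using c(1) by simp
    also have "\<dots> \<le> dist (T x) m" using w(2) n(2) by (simp add: dist_norm T.diff)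
    finally show "c * infdist x M \<le> infdist (T x) M + e" using m(2) by linarith
  qed
  then show "c * infdist x (hyperrange T) \<le> infdist (T x) (hyperrange T)" for x
    by (simp add: M_def)
qed

text \<open>
  The constant \<open>c\<close> governs both surjectivity on the hyperrange and the lower bound modulo it, so both
  survive a perturbation of norm less than \<open>c\<close> as soon as it leaves the hyperrange of \<open>T\<close> invariant.
\<close>

lemma semi_regular_perturbation:
  fixes T :: "'v::right_quat_hilbert \<Rightarrow> 'v"
  assumes sr: "semi_regular T" and c: "0 < c" "lifts_with c T"
    and T': "T' \<in> bounded_right_ops"
    and inv: "\<And>x. x \<in> hyperrange T \<Longrightarrow> T' x \<in> hyperrange T"
    and \<delta>: "0 \<le> \<delta>" "\<delta> < c" "\<And>x. norm (T' x - T x) \<le> \<delta> * norm x"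
  shows "semi_regular T'"
proof -
  define M where "M = hyperrange T"
  note props = semi_regular_hyperrange[OF sr c, folded M_def]
  have T: "bounded_linear T" using sr by (auto simp: semi_regular_def dest: bounded_right_opsD)
  have M: "subspace M" unfolding M_def using T by (rule subspace_hyperrange)
  show ?thesis
  proof (rule semi_regularI_invariant_subspace[OF T' M props(1)])
    show "T' x \<in> M" if "x \<in> M" for x using inv that by (simp add: M_def)
    show "0 \<le> 1 / c" "0 \<le> \<delta> / c" "\<delta> / c < 1" "0 < c - \<delta>" using c \<delta> by auto
    show "\<exists>x\<in>M. norm x \<le> 1 / c * norm y \<and> norm (T' x - y) \<le> \<delta> / c * norm y" if y: "y \<in> M" for y
    proof -
      obtain x where x: "x \<in> M" "T x = y" "c * norm x \<le> norm y" using props(3)[OF y] by blast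
      then have *: "norm x \<le> norm y / c" using c(1) by (simp add: field_simps)
      have "norm (T' x - y) \<le> \<delta> * norm x" using \<delta>(3)[of x] x(2) by simp
      also have "\<dots> \<le> \<delta> * (norm y / c)" using * \<delta>(1) by (rule mult_left_mono)
      finally show ?thesis using x(1) * by auto
    qed
    show "(c - \<delta>) * infdist x M \<le> infdist (T' x) M" for x
    proof -
      have lin: "linear (\<lambda>x. T x - T' x)"
        using T bounded_right_opsD[OF T'] by (intro linear_compose_sub bounded_linear.linear)
      have "infdist (T x - T' x) M \<le> \<delta> * infdist x M"
        using inv props(2) M \<delta> lin
        by (intro infdist_invariant_subspace_le[of M "\<lambda>x. T x - T' x"])
          (auto simp: M_def norm_minus_commute intro: subspace_diff)
      moreover have "infdist (T x) M \<le> infdist (T' x) M + infdist (T x - T' x) M"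
        using infdist_subspace_add[OF M, of "T' x" "T x - T' x"] by simp
      ultimately show ?thesis using props(4)[of x] by (simp add: algebra_simps)
    qed
  qed
qed

section \<open>The operators \<open>R_op q A\<close>\<close>

lemma R_op_eq: "R_op q A x = A (A x) - (2 * qRe q) *\<^sub>R A x + (norm q)\<^sup>2 *\<^sub>R x"
  by (simp add: R_op_def numeral_2_eq_2)

lemma scaleR_scaleQ_commute: "(r *\<^sub>R x) *\<^sub>H q = r *\<^sub>R (x *\<^sub>H q)"
proof -
  have "of_real r * q = q * of_real r"
    by (simp add: of_real_def)
  then show ?thesis by (simp add: scaleR_eq_scaleQ flip: scaleQ_mult)
qed

lemma scaleQ_diff_left: "(x - y) *\<^sub>H q = x *\<^sub>H q - y *\<^sub>H q"
  using scaleQ_add_left[of "x - y" y q] by simp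

lemma R_op_bounded_right_op:
  assumes "A \<in> bounded_right_ops"
  shows "R_op q A \<in> bounded_right_ops"
proof -
  have A: "bounded_linear A" and AQ: "\<And>x p. A (x *\<^sub>H p) = A x *\<^sub>H p"
    using assms by (auto simp: bounded_right_ops_def)
  have "bounded_linear (\<lambda>x. A (A x) - (2 * qRe q) *\<^sub>R A x + (norm q)\<^sup>2 *\<^sub>R x)"
    by (intro bounded_linear_add bounded_linear_sub bounded_linear_compose[OF A A] A
        bounded_linear_compose[OF bounded_linear_scaleR_right A] bounded_linear_scaleR_right)
  then show ?thesis
    by (simp add: bounded_right_ops_def R_op_eq[abs_def] AQ scaleQ_add_left scaleQ_diff_left
        scaleR_scaleQ_commute)
qed

text \<open>
  Treating \<open>R_op q A\<close> as a perturbation of \<open>A ^^ 2\<close> by an operator of small norm would lose too much,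
  because \<open>A\<close> may have a large norm. On \<open>M\<close> the term \<open>(2 * qRe q) *\<^sub>R A x\<close> is instead
  measured by the intermediate solution \<open>z = A x\<close>, and on the quotient it is absorbed into the lower bound
  for \<open>A (A x)\<close>.
\<close>

lemma semi_regular_R_op:
  fixes A :: "'v::right_quat_hilbert \<Rightarrow> 'v"
  assumes sr: "semi_regular A" and c: "0 < c" "lifts_with c A"
    and q: "2 * \<bar>qRe q\<bar> * c + (norm q)\<^sup>2 < c\<^sup>2"
  shows "semi_regular (R_op q A)"
proof -
  define M where "M = hyperrange A"
  note props = semi_regular_hyperrange[OF sr c, folded M_def]
  have Aop: "A \<in> bounded_right_ops" using sr by (simp add: semi_regular_def)
  interpret A: bounded_linear A using Aop by (rule bounded_right_opsD)
  have M: "subspace M" unfolding M_def by (rule subspace_hyperrange[OF A.bounded_linear_axioms])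
  define a b where "a = 2 * \<bar>qRe q\<bar>" and "b = (norm q)\<^sup>2"
  have ab: "0 \<le> a" "0 \<le> b" "a * c + b < c\<^sup>2" using q by (auto simp: a_def b_def)
  then have "a * c < c * c" by (simp add: power2_eq_square)
  then have ac: "a < c" using c(1) by simp
  show ?thesis
  proof (rule semi_regularI_invariant_subspace[OF R_op_bounded_right_op[OF Aop] M props(1)])
    show "R_op q A x \<in> M" if "x \<in> M" for x
      unfolding R_op_eq using that M props(2) by (auto intro!: subspace_add subspace_diff subspace_scale)
    show "0 \<le> 1 / c\<^sup>2" by simp
    show "0 \<le> (a * c + b) / c\<^sup>2" "(a * c + b) / c\<^sup>2 < 1" using c(1) ab by auto
    show "0 < c\<^sup>2 - a * c - b" using ab by simp
    show "\<exists>x\<in>M. norm x \<le> 1 / c\<^sup>2 * norm y \<and> norm (R_op q A x - y) \<le> (a * c + b) / c\<^sup>2 * norm y"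
      if y: "y \<in> M" for y
    proof -
      obtain z where z: "z \<in> M" "A z = y" "c * norm z \<le> norm y" using props(3)[OF y] by blast
      obtain x where x: "x \<in> M" "A x = z" "c * norm x \<le> norm z" using props(3)[OF z(1)] by blast
      have z': "norm z \<le> norm y / c" using z(3) c(1) by (simp add: field_simps)
      have "c * (c * norm x) \<le> norm y" using mult_left_mono[OF x(3), of c] z(3) c(1) by linarith
      then have x': "norm x \<le> norm y / c\<^sup>2" using c(1) by (simp add: field_simps power2_eq_square)
      have "norm (R_op q A x - y) = norm (b *\<^sub>R x - (2 * qRe q) *\<^sub>R z)"
        by (simp add: R_op_eq z x b_def algebra_simps)
      also have "\<dots> \<le> b * norm x + a * norm z"
        using norm_triangle_ineq4[of "b *\<^sub>R x" "(2 * qRe q) *\<^sub>R z"] ab by (simp add: a_def abs_mult)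
      also have "\<dots> \<le> b * (norm y / c\<^sup>2) + a * (norm y / c)"
        using ab x' z' by (intro add_mono mult_left_mono) auto
      also have "\<dots> = (a * c + b) / c\<^sup>2 * norm y"
        using c(1) by (simp add: field_simps power2_eq_square)
      finally show ?thesis using x(1) x' by auto
    qed
    show "(c\<^sup>2 - a * c - b) * infdist x M \<le> infdist (R_op q A x) M" for x
    proof -
      have "A (A x) = R_op q A x + ((2 * qRe q) *\<^sub>R A x + (- b) *\<^sub>R x)"
        by (simp add: R_op_eq b_def)
      then have "infdist (A (A x)) M \<le> infdist (R_op q A x) M +
          (infdist ((2 * qRe q) *\<^sub>R A x) M + infdist ((- b) *\<^sub>R x) M)"
        using infdist_subspace_add[OF M, of "R_op q A x"]
          infdist_subspace_add[OF M, of "(2 * qRe q) *\<^sub>R A x" "(- b) *\<^sub>R x"]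
        by (metis add_left_mono order_trans)
      also have "\<dots> \<le> infdist (R_op q A x) M + (a * infdist (A x) M + b * infdist x M)"
        using infdist_subspace_scaleR[OF M, of "2 * qRe q" "A x"]
          infdist_subspace_scaleR[OF M, of "- b" x] ab by (simp add: a_def abs_mult)
      finally have "(c - a) * infdist (A x) M \<le> infdist (R_op q A x) M + b * infdist x M"
        using props(4)[of "A x"] by (simp add: algebra_simps)
      moreover have "(c - a) * (c * infdist x M) \<le> (c - a) * infdist (A x) M"
        using props(4)[of x] ac by (intro mult_left_mono) auto
      ultimately show ?thesis by (simp add: algebra_simps power2_eq_square)
    qed
  qed
qed

text \<open>
  \<open>beta q\<close> is the larger root of \<open>c\<^sup>2 - 2 * \<bar>qRe q\<bar> * c - (norm q)\<^sup>2\<close>.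
\<close>

lemma quadratic_bound_of_beta_less:
  assumes "beta q < c"
  shows "2 * \<bar>qRe q\<bar> * c + (norm q)\<^sup>2 < c\<^sup>2"
proof -
  have "sqrt (\<bar>qRe q\<bar>\<^sup>2 + (norm q)\<^sup>2) < c - \<bar>qRe q\<bar>"
    using assms by (simp add: beta_def)
  then have "(sqrt (\<bar>qRe q\<bar>\<^sup>2 + (norm q)\<^sup>2))\<^sup>2 < (c - \<bar>qRe q\<bar>)\<^sup>2"
    by (intro power_strict_mono) auto
  then show ?thesis by (simp add: power2_diff algebra_simps)
qed

text \<open>
  Passing from \<open>d\<close> to the smaller constant \<open>c\<close> leaves room for an element \<open>k\<close> of the kernel that is only
  almost nearest to \<open>x\<close>; the difference \<open>x - k\<close> is the short preimage of \<open>A x\<close>. For \<open>A = 0\<close> the modulus is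
  infinite, and any constant works because every value is \<open>0\<close>.
\<close>

lemma lifts_with_below_reduced_min_modulus:
  fixes A :: "'v::right_quat_hilbert \<Rightarrow> 'v"
  assumes sr: "semi_regular A" and t: "0 \<le> t" "ereal t < reduced_min_modulus A"
  obtains c where "t < c" "lifts_with c A"
proof -
  interpret A: bounded_linear A
    using sr by (intro bounded_right_opsD) (simp add: semi_regular_def)
  have ker: "subspace (ker A)" unfolding ker_def
    using linear_subspace_kernel[OF A.linear_axioms] .
  obtain d where d: "t < d" "ereal d < reduced_min_modulus A"
    using t(2) ereal_dense2 by (metis less_ereal.simps(1))
  have lower: "d * infdist x (ker A) \<le> norm (A x)" for x
  proof (cases "x \<in> ker A")
    case False
    then have "reduced_min_modulus A \<le> ereal (norm (A x) / infdist x (ker A))"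
      unfolding reduced_min_modulus_def by (auto simp: ker_def intro!: INF_lower)
    then have "d \<le> norm (A x) / infdist x (ker A)"
      using d(2) by (metis ereal_less_eq(3) less_le_trans less_imp_le)
    then show ?thesis
      using infdist_nonneg[of x "ker A"] by (cases "infdist x (ker A) = 0") (auto simp: field_simps)
  qed auto
  define c where "c = (t + d) / 2"
  have c: "t < c" "0 < c" "c < d" using d t by (auto simp: c_def)
  have "lifts_with c A"
    unfolding lifts_with_def
  proof
    fix x
    show "\<exists>x'. A x' = A x \<and> c * norm x' \<le> norm (A x)"
    proof (cases "A x = 0")
      case True
      then show ?thesis by (intro exI[of _ 0]) (simp add: A.zero)
    next
      case False
      have "infdist x (ker A) \<le> norm (A x) / d" using lower[of x] c by (simp add: field_simps)
      also have "\<dots> < norm (A x) / c" using c False by (intro divide_strict_left_mono) auto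
      finally obtain k where k: "k \<in> ker A" "dist x k < norm (A x) / c"
        using infdist_subspace_near[OF ker, of "norm (A x) / c - infdist x (ker A)" x] by auto
      then show ?thesis using c
        by (intro exI[of _ "x - k"]) (auto simp: A.diff ker_def dist_norm field_simps)
    qed
  qed
  then show ?thesis using that c(1) by blast
qed

section \<open>The Kato S-spectrum is compact\<close>

lemma continuous_on_qRe: "continuous_on S qRe"
proof -
  have "bounded_linear qRe"
    by (rule bounded_linear_intro[of _ 1]) (auto simp: norm_quat_def intro!: real_le_rsqrt)
  then show ?thesis by (rule linear_continuous_on)
qed

text \<open>
  One subspace, the hyperrange of \<open>R_op p A\<close>, serves for all \<open>q\<close> near \<open>p\<close>.
\<close>

lemma open_kato_S_resolvent_set:
  fixes A :: "'v::right_quat_hilbert \<Rightarrow> 'v"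
  assumes A: "A \<in> bounded_right_ops"
  shows "open (kato_S_resolvent_set A)"
proof (subst open_subopen, intro ballI)
  interpret A: bounded_linear A using A by (rule bounded_right_opsD)
  obtain K where K: "0 \<le> K" "\<And>x. norm (A x) \<le> K * norm x"
    using A.nonneg_bounded by (auto simp: mult.commute)
  fix p assume "p \<in> kato_S_resolvent_set A"
  then have p: "semi_regular (R_op p A)" by (simp add: kato_S_resolvent_set_def)
  define T where "T = R_op p A"
  have T: "bounded_linear T" "closed (range T)"
    using p by (auto simp: T_def semi_regular_def dest: bounded_right_opsD)
  obtain c where c: "0 < c" "lifts_with c T"
    using closed_range_imp_lifts_with[OF T] .
  have AT: "A (T x) = T (A x)" for x
    by (simp add: T_def R_op_eq A.add A.diff A.scaleR)
  have A_pow: "A ((T ^^ n) x) = (T ^^ n) (A x)" for n x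
    by (induction n) (simp_all add: AT)
  have A_inv: "A x \<in> hyperrange T" if x: "x \<in> hyperrange T" for x
  proof -
    have "A x \<in> range (T ^^ n)" for n
    proof -
      obtain u where "x = (T ^^ n) u" using x by (auto simp: hyperrange_def)
      then have "A x = (T ^^ n) (A u)" by (simp add: A_pow)
      then show ?thesis by blast
    qed
    then show ?thesis by (auto simp: hyperrange_def)
  qed
  \<comment> \<open>a bound for the norm of \<open>R_op q A - R_op p A\<close>, continuous in \<open>q\<close> and zero at \<open>p\<close>\<close>
  define \<delta> where "\<delta> q = 2 * \<bar>qRe p - qRe q\<bar> * K + \<bar>(norm q)\<^sup>2 - (norm p)\<^sup>2\<bar>" for q
  have diff: "norm (R_op q A x - T x) \<le> \<delta> q * norm x" for q x
  proof -
    have "R_op q A x - T x = (2 * (qRe p - qRe q)) *\<^sub>R A x + ((norm q)\<^sup>2 - (norm p)\<^sup>2) *\<^sub>R x"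
      by (simp add: R_op_eq T_def algebra_simps)
    also have "norm \<dots> \<le> \<bar>2 * (qRe p - qRe q)\<bar> * norm (A x) + \<bar>(norm q)\<^sup>2 - (norm p)\<^sup>2\<bar> * norm x"
      by (rule norm_triangle_le) (simp only: norm_scaleR order_refl)
    also have "\<dots> = 2 * \<bar>qRe p - qRe q\<bar> * norm (A x) + \<bar>(norm q)\<^sup>2 - (norm p)\<^sup>2\<bar> * norm x"
      by (simp only: abs_mult abs_numeral)
    also have "\<dots> \<le> 2 * \<bar>qRe p - qRe q\<bar> * (K * norm x) + \<bar>(norm q)\<^sup>2 - (norm p)\<^sup>2\<bar> * norm x"
      using K(2) by (intro add_mono mult_left_mono) auto
    finally show ?thesis by (simp add: \<delta>_def algebra_simps)
  qed
  let ?U = "{q. \<delta> q < c}"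
  have "open ?U"
    unfolding \<delta>_def by (intro open_Collect_less continuous_intros continuous_on_qRe)
  moreover have "p \<in> ?U" using c by (simp add: \<delta>_def)
  moreover have "?U \<subseteq> kato_S_resolvent_set A"
  proof
    fix q assume "q \<in> ?U"
    have "semi_regular (R_op q A)"
    proof (rule semi_regular_perturbation[OF p[folded T_def] c R_op_bounded_right_op[OF A]])
      show "R_op q A x \<in> hyperrange T" if "x \<in> hyperrange T" for x
        unfolding R_op_eq using that subspace_hyperrange[OF T(1)] A_inv
        by (auto intro!: subspace_add subspace_diff subspace_scale)
      show "0 \<le> \<delta> q" using K(1) by (simp add: \<delta>_def)
      show "\<delta> q < c" using \<open>q \<in> ?U\<close> by simp
    qed (rule diff)
    then show "q \<in> kato_S_resolvent_set A" by (simp add: kato_S_resolvent_set_def)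
  qed
  ultimately show "\<exists>U. open U \<and> p \<in> U \<and> U \<subseteq> kato_S_resolvent_set A" by blast
qed

lemma abs_qRe_le_norm: "\<bar>qRe q\<bar> \<le> norm q"
  and abs_qIm1_le_norm: "\<bar>qIm1 q\<bar> \<le> norm q"
  and abs_qIm2_le_norm: "\<bar>qIm2 q\<bar> \<le> norm q"
  and abs_qIm3_le_norm: "\<bar>qIm3 q\<bar> \<le> norm q"
  by (auto simp: norm_quat_def intro!: real_le_rsqrt)

text \<open>
  For \<open>norm q > 3 * K\<close> the vector \<open>x = y / (norm q)\<^sup>2\<close> solves \<open>R_op q A x = y\<close> up to the relative error
  \<open>1/9 + 2/3 = 7/9\<close>, from the quadratic and the linear term, so \<open>R_op q A\<close> is surjective. With the whole
  space as invariant subspace the quotient condition is trivial.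
\<close>

lemma kato_S_spectrum_bound:
  fixes A :: "'v::right_quat_hilbert \<Rightarrow> 'v"
  assumes A: "A \<in> bounded_right_ops"
    and K: "0 < K" "\<And>x. norm (A x) \<le> K * norm x"
    and q: "q \<in> kato_S_spectrum A"
  shows "norm q \<le> 3 * K"
proof (rule ccontr)
  assume "\<not> ?thesis"
  then have r: "3 * K < norm q" by simp
  define r where "r = norm q"
  have r: "3 * K < r" "0 < r" using r K by (auto simp: r_def)
  have "semi_regular (R_op q A)"
  proof (rule semi_regularI_invariant_subspace[OF R_op_bounded_right_op[OF A] subspace_UNIV closed_UNIV])
    show "0 \<le> 1 / r\<^sup>2" "(0::real) \<le> 7/9" "(7::real)/9 < 1" "(0::real) < 1" by auto
    show "1 * infdist x UNIV \<le> infdist (R_op q A x) UNIV" for x by simp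
    show "\<exists>x\<in>UNIV. norm x \<le> 1 / r\<^sup>2 * norm y \<and> norm (R_op q A x - y) \<le> 7/9 * norm y" for y
    proof -
      define x where "x = y /\<^sub>R r\<^sup>2"
      have y: "y = r\<^sup>2 *\<^sub>R x" using r by (simp add: x_def)
      have Ax: "norm (A x) \<le> r / 3 * norm x"
        using K(2)[of x] mult_right_mono[of K "r / 3" "norm x"] r by simp
      have AAx: "norm (A (A x)) \<le> r\<^sup>2 / 9 * norm x"
      proof -
        have "norm (A (A x)) \<le> r / 3 * norm (A x)"
          using K(2)[of "A x"] mult_right_mono[of K "r / 3" "norm (A x)"] r by simp
        also have "\<dots> \<le> r / 3 * (r / 3 * norm x)" using Ax r by (intro mult_left_mono) auto
        finally show ?thesis by (simp add: power2_eq_square)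
      qed
      have "norm (R_op q A x - y) = norm (A (A x) - (2 * qRe q) *\<^sub>R A x)"
        by (simp add: R_op_eq y r_def)
      also have "\<dots> \<le> norm (A (A x)) + 2 * \<bar>qRe q\<bar> * norm (A x)"
        using norm_triangle_ineq4[of "A (A x)" "(2 * qRe q) *\<^sub>R A x"] by (simp add: abs_mult)
      also have "\<dots> \<le> r\<^sup>2 / 9 * norm x + 2 * r * (r / 3 * norm x)"
        using AAx Ax abs_qRe_le_norm[of q] r
        by (intro add_mono mult_mono) (auto simp: r_def)
      also have "\<dots> = 7/9 * norm y" by (simp add: y power2_eq_square)
      finally have "norm (R_op q A x - y) \<le> 7/9 * norm y" .
      moreover have "norm x \<le> 1 / r\<^sup>2 * norm y" using r(2) by (simp add: y)
      ultimately show ?thesis by blast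
    qed
  qed auto
  then show False using q by (simp add: kato_S_spectrum_def kato_S_resolvent_set_def)
qed

text \<open>
  Heine-Borel for quaternions, transported from the box in four real coordinates.
\<close>

lemma quat_closed_bounded_imp_compact:
  fixes S :: "quat set"
  assumes "closed S" and bound: "\<And>q. q \<in> S \<Longrightarrow> norm q \<le> B"
  shows "compact S"
proof -
  define f where "f = (\<lambda>(a, b, c, d). a *\<^sub>R 1 + b *\<^sub>R Quat 0 1 0 0 + c *\<^sub>R Quat 0 0 1 0 + d *\<^sub>R Quat 0 0 0 1)"
  let ?I = "{-B..B}"
  let ?Q = "?I \<times> ?I \<times> ?I \<times> ?I"
  have "continuous_on ?Q f"
    unfolding f_def case_prod_beta by (intro continuous_intros)
  then have "compact (f ` ?Q)"
    by (intro compact_continuous_image compact_Times compact_Icc)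
  moreover have "S \<subseteq> f ` ?Q"
  proof
    fix q assume "q \<in> S"
    then have "norm q \<le> B" by (rule bound)
    then have "(qRe q, qIm1 q, qIm2 q, qIm3 q) \<in> ?Q"
      using abs_qRe_le_norm[of q] abs_qIm1_le_norm[of q] abs_qIm2_le_norm[of q] abs_qIm3_le_norm[of q]
      by (auto simp: abs_le_iff)
    moreover have "q = f (qRe q, qIm1 q, qIm2 q, qIm3 q)"
      by (simp add: f_def quat_eq_iff)
    ultimately show "q \<in> f ` ?Q" by blast
  qed
  ultimately show ?thesis using assms(1) by (metis compact_Int_closed inf.absorb_iff2)
qed

theorem theorem7p6:
  fixes A :: "'v::right_quat_hilbert \<Rightarrow> 'v"
  assumes "A \<in> bounded_right_ops"
    and "semi_regular A"
  shows "(\<forall>q. reduced_min_modulus A > ereal (beta q) \<longrightarrow> semi_regular (R_op q A))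
    \<and> open (kato_S_resolvent_set A)
    \<and> compact (kato_S_spectrum A)"
proof (intro conjI allI impI)
  fix q assume q: "reduced_min_modulus A > ereal (beta q)"
  have beta: "0 \<le> beta q" by (simp add: beta_def)
  obtain c where c: "beta q < c" "lifts_with c A"
    using lifts_with_below_reduced_min_modulus[OF assms(2) beta q] .
  then show "semi_regular (R_op q A)"
    using beta by (intro semi_regular_R_op[OF assms(2) _ c(2)] quadratic_bound_of_beta_less) auto
next
  show op: "open (kato_S_resolvent_set A)" using assms(1) by (rule open_kato_S_resolvent_set)
  obtain K where K: "0 < K" "\<And>x. norm (A x) \<le> K * norm x"
    using bounded_linear.pos_bounded[OF bounded_right_opsD[OF assms(1)]] by (auto simp: mult.commute)
  show "compact (kato_S_spectrum A)"
  proof (rule quat_closed_bounded_imp_compact)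
    show "closed (kato_S_spectrum A)"
      using op by (simp add: kato_S_spectrum_def closed_def)
    show "norm q \<le> 3 * K" if "q \<in> kato_S_spectrum A" for q
      using kato_S_spectrum_bound[OF assms(1) K that] .
  qed
qed

end
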